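(* Let $a<b$ be real numbers with $a>0$, and let $\widetilde{H}^{1}(a,b)$ denote the subspace of functions $w\in H^{1}(a,b)$ satisfying $w(b)=0$. Then for every $\lambda>0$ and every $w\in\widetilde{H}^{1}(a,b)$, $$\int_{a}^{b}(w')^{2}e^{2\lambda y}\,dy\;\geq\;\frac12\int_{a}^{b}(w')^{2}e^{2\lambda y}\,dy+\frac12\lambda^{2}\int_{a}^{b}w^{2}e^{2\lambda y}\,dy .$$
   Context: All functions are real valued. $H^1(a,b)$ is the usual Sobolev space on the interval $(a,b)$; its elements are identified with their continuous representatives on $[a,b]$, so that $w(b)$ makes sense. *)

theory Defs
  imports "HOL-Analysis.Analysis"
begin

text \<open>Functions on the open interval \<open>(a,b)\<close> are represented by total functions on the reals;
  their values outside the interval never enter. Measurability and integrals refer to the completed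
  Lebesgue measure.\<close>

definition test_fun_on :: "real \<Rightarrow> real \<Rightarrow> (real \<Rightarrow> real) \<Rightarrow> bool" where
  "test_fun_on a b \<phi> \<longleftrightarrow>
     (\<forall>k x. (deriv ^^ k) \<phi> field_differentiable at x) \<and>
     compact (closure {x. \<phi> x \<noteq> 0}) \<and> closure {x. \<phi> x \<noteq> 0} \<subseteq> {a<..<b}"

definition locally_integrable_on :: "real \<Rightarrow> real \<Rightarrow> (real \<Rightarrow> real) \<Rightarrow> bool" where
  "locally_integrable_on a b f \<longleftrightarrow>
     (\<forall>K. compact K \<and> K \<subseteq> {a<..<b} \<longrightarrow> set_integrable lebesgue K f)"

text \<open>A weak derivative is determined only almost everywhere, hence a relation.\<close>

definition has_weak_derivative_on ::
    "real \<Rightarrow> real \<Rightarrow> (real \<Rightarrow> real) \<Rightarrow> (real \<Rightarrow> real) \<Rightarrow> bool" where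
  "has_weak_derivative_on a b u g \<longleftrightarrow>
     locally_integrable_on a b u \<and> locally_integrable_on a b g \<and>
     (\<forall>\<phi>. test_fun_on a b \<phi> \<longrightarrow>
        (LINT x:{a<..<b}|lebesgue. u x * deriv \<phi> x) = - (LINT x:{a<..<b}|lebesgue. g x * \<phi> x))"

definition L2_on :: "real \<Rightarrow> real \<Rightarrow> (real \<Rightarrow> real) set" where
  "L2_on a b = {f. set_borel_measurable lebesgue {a<..<b} f \<and>
                   set_integrable lebesgue {a<..<b} (\<lambda>x. (f x)\<^sup>2)}"

text \<open>Elements of \<open>H\<^sup>1(a,b)\<close> are taken as their continuous representatives on \<open>[a,b]\<close>, so that
  point values at the end points make sense.\<close>

definition H1 :: "real \<Rightarrow> real \<Rightarrow> (real \<Rightarrow> real) set" where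
  "H1 a b = {w. continuous_on {a..b} w \<and> w \<in> L2_on a b \<and>
                (\<exists>g \<in> L2_on a b. has_weak_derivative_on a b w g)}"

definition H1_tilde :: "real \<Rightarrow> real \<Rightarrow> (real \<Rightarrow> real) set" where
  "H1_tilde a b = {w \<in> H1 a b. w b = 0}"

end

theory Submission
  imports Defs
begin

text \<open>
  Testing the weak derivative against smooth approximations of the indicator functions of intervals
  shows that \<open>w y - w x\<close> is the integral of \<open>w'\<close> over \<open>[x, y]\<close>. In particular \<open>w'\<close> is unique almost
  everywhere, hence square integrable. Since \<open>w b = 0\<close>, the Cauchy-Schwarz inequality with the weights
  \<open>exp (\<plusminus> lam t)\<close> bounds \<open>(w y)\<^sup>2\<close> by \<open>exp (- lam y) / lam\<close> times the integral of
  \<open>(w' t)\<^sup>2 exp (lam t)\<close> over \<open>[y, b]\<close>. Multiplying by \<open>exp (2 lam y)\<close>, integrating over \<open>y\<close> and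
  exchanging the integrals gives \<open>lam\<^sup>2 \<integral> w\<^sup>2 exp (2 lam y) \<le> \<integral> w'\<^sup>2 exp (2 lam y)\<close>.
\<close>

section \<open>A smooth step function\<close>

text \<open>An existential recursion in place of iterated \<open>deriv\<close>: closure under sums,
  products and inverses then follows by induction, with the differentiation rules supplying the
  witnesses.\<close>

primrec times_differentiable :: "nat \<Rightarrow> (real \<Rightarrow> real) \<Rightarrow> bool" where
  "times_differentiable 0 f \<longleftrightarrow> True"
| "times_differentiable (Suc n) f \<longleftrightarrow>
     (\<exists>f'. (\<forall>x. (f has_real_derivative f' x) (at x)) \<and> times_differentiable n f')"

lemma times_differentiable_SucI:
  assumes "\<And>x. (f has_real_derivative f' x) (at x)" "times_differentiable n f'"
  shows "times_differentiable (Suc n) f"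
  using assms by auto

lemma times_differentiable_SucD: "times_differentiable (Suc n) f \<Longrightarrow> times_differentiable n f"
  by (induction n arbitrary: f) auto

text \<open>Bridge to the smoothness clause of \<open>test_fun_on\<close>: any witness
  \<open>f'\<close> must coincide with \<open>deriv f\<close>.\<close>

lemma times_differentiable_funpow_deriv:
  "times_differentiable (Suc n) f \<Longrightarrow> (deriv ^^ n) f field_differentiable at x"
proof (induction n arbitrary: f)
  case 0
  then show ?case by (auto simp: field_differentiable_def)
next
  case (Suc n)
  then obtain f' where f': "\<And>x. (f has_real_derivative f' x) (at x)" "times_differentiable (Suc n) f'"
    by auto
  have "deriv f = f'"
    using f'(1) by (auto intro: DERIV_imp_deriv)
  then show ?case
    using Suc.IH[OF f'(2)] by (simp add: funpow_swap1)
qed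

lemma times_differentiable_const: "times_differentiable n (\<lambda>x. c)"
proof (induction n arbitrary: c)
  case (Suc n)
  show ?case by (rule times_differentiable_SucI[where f' = "\<lambda>x. 0"]) (auto intro: Suc)
qed simp

lemma times_differentiable_add:
  "times_differentiable n f \<Longrightarrow> times_differentiable n g \<Longrightarrow> times_differentiable n (\<lambda>x. f x + g x)"
proof (induction n arbitrary: f g)
  case (Suc n)
  from Suc.prems obtain f' g' where
    f': "\<And>x. (f has_real_derivative f' x) (at x)" "times_differentiable n f'" and
    g': "\<And>x. (g has_real_derivative g' x) (at x)" "times_differentiable n g'" by auto
  show ?case
    by (rule times_differentiable_SucI[where f' = "\<lambda>x. f' x + g' x"])
       (auto intro!: derivative_eq_intros f' g' Suc.IH)
qed simp

lemma times_differentiable_mult: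
  "times_differentiable n f \<Longrightarrow> times_differentiable n g \<Longrightarrow> times_differentiable n (\<lambda>x. f x * g x)"
proof (induction n arbitrary: f g)
  case (Suc n)
  from Suc.prems obtain f' g' where
    f': "\<And>x. (f has_real_derivative f' x) (at x)" "times_differentiable n f'" and
    g': "\<And>x. (g has_real_derivative g' x) (at x)" "times_differentiable n g'" by auto
  show ?case
    by (rule times_differentiable_SucI[OF DERIV_mult[OF f'(1) g'(1)]])
       (intro times_differentiable_add Suc.IH f' g' Suc.prems[THEN times_differentiable_SucD])
qed simp

lemma times_differentiable_diff:
  assumes "times_differentiable n f" "times_differentiable n g"
  shows "times_differentiable n (\<lambda>x. f x - g x)"
  using times_differentiable_add[OF assms(1)
      times_differentiable_mult[OF times_differentiable_const[of n "-1"] assms(2)]]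
  by simp

text \<open>The derivative is a product of \<open>f'\<close> and two copies of
  \<open>inverse f\<close>, all of which are covered at order \<open>n\<close>.\<close>

lemma times_differentiable_inverse:
  assumes nz: "\<And>x. f x \<noteq> 0"
  shows "times_differentiable n f \<Longrightarrow> times_differentiable n (\<lambda>x. inverse (f x))"
proof (induction n)
  case (Suc n)
  from Suc.prems obtain f' where
    f': "\<And>x. (f has_real_derivative f' x) (at x)" "times_differentiable n f'" by auto
  have inv: "times_differentiable n (\<lambda>x. inverse (f x))"
    using Suc.IH Suc.prems times_differentiable_SucD by blast
  show ?case
  proof (rule times_differentiable_SucI)
    show "((\<lambda>x. inverse (f x)) has_real_derivative - 1 * (inverse (f x) * f' x * inverse (f x))) (at x)" for x
      using DERIV_inverse'[OF f'(1) nz] by simp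
    show "times_differentiable n (\<lambda>x. - 1 * (inverse (f x) * f' x * inverse (f x)))"
      by (intro times_differentiable_mult times_differentiable_const inv f')
  qed
qed simp

lemma times_differentiable_affine:
  "times_differentiable n f \<Longrightarrow> times_differentiable n (\<lambda>x. f (c * x + d))"
proof (induction n arbitrary: f)
  case (Suc n)
  from Suc.prems obtain f' where
    f': "\<And>x. (f has_real_derivative f' x) (at x)" "times_differentiable n f'" by auto
  have "((\<lambda>x. f (c * x + d)) has_real_derivative f' (c * x + d) * c) (at x)" for x
    by (rule DERIV_chain2[OF f'(1)]) (auto intro!: derivative_eq_intros)
  then show ?case
    by (rule times_differentiable_SucI)
       (auto intro!: times_differentiable_mult times_differentiable_const Suc.IH f')
qed simp

text \<open>Differentiation maps the family \<open>flat k\<close> into its own linear span, so all its members are smooth.\<close>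

definition flat :: "nat \<Rightarrow> real \<Rightarrow> real" where
  "flat k x = (if 0 < x then exp (- 1 / x) / x ^ k else 0)"

text \<open>With \<open>u = 1 / x\<close> the limit from the right is that of
  \<open>u ^ k / exp u\<close> as \<open>u\<close> tends to infinity; to the left of 0 the function
  vanishes.\<close>

lemma flat_tendsto_0: "(flat k \<longlongrightarrow> 0) (at 0)"
proof -
  have "((\<lambda>x::real. inverse x ^ k / exp (inverse x)) \<longlongrightarrow> 0) (at_right 0)"
    by (rule filterlim_compose[OF tendsto_power_div_exp_0 filterlim_inverse_at_top_right])
  moreover have "eventually (\<lambda>x. inverse x ^ k / exp (inverse x) = flat k x) (at_right 0)"
    by (auto simp: eventually_at_filter flat_def exp_minus field_simps)
  ultimately have "(flat k \<longlongrightarrow> 0) (at_right 0)"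
    by (rule Lim_transform_eventually)
  moreover have "(flat k \<longlongrightarrow> 0) (at_left 0)"
    by (rule Lim_transform_eventually[OF tendsto_const])
       (auto simp: eventually_at_filter flat_def)
  ultimately show ?thesis
    by (intro filterlim_split_at)
qed

lemma has_real_derivative_flat:
  "(flat k has_real_derivative flat (k + 2) x - real k * flat (k + 1) x) (at x)"
proof (cases "x = 0")
  case True
  \<comment> \<open>The difference quotient of \<open>flat k\<close> at 0 is
    \<open>flat (k + 1)\<close>, whose limit at 0 is already known.\<close>
  have "flat (k + 1) = (\<lambda>h. flat k h / h)"
    by (rule ext) (simp add: flat_def)
  then have "((\<lambda>h. flat k h / h) \<longlongrightarrow> 0) (at 0)"
    using flat_tendsto_0[of "k + 1"] by simp
  moreover have "flat m 0 = 0" for m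
    by (simp add: flat_def)
  ultimately show ?thesis
    using True by (simp add: DERIV_def)
next
  case False
  then consider "x > 0" | "x < 0" by linarith
  then show ?thesis
  proof cases
    case 1
    have "((\<lambda>x. exp (- 1 / x) / x ^ k) has_real_derivative flat (k + 2) x - real k * flat (k + 1) x) (at x)"
    \<comment> \<open>The power rule produces \<open>x ^ (k - 1)\<close>; separating
      \<open>k = 0\<close> avoids truncated subtraction.\<close>
    proof (cases k)
      case 0
      then show ?thesis
        using 1 by (auto intro!: derivative_eq_intros simp: flat_def power2_eq_square)
    next
      case (Suc m)
      have "((\<lambda>x. exp (- 1 / x)) has_real_derivative exp (- 1 / x) * (1 / x\<^sup>2)) (at x)"
        using 1 by (auto intro!: derivative_eq_intros simp: power2_eq_square)
      from DERIV_divide[OF this DERIV_pow[of k x UNIV]]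
      have "((\<lambda>x. exp (- 1 / x) / x ^ k) has_real_derivative
          (exp (- 1 / x) * (1 / x\<^sup>2) * x ^ k - exp (- 1 / x) * (real k * x ^ m)) / (x ^ k * x ^ k)) (at x)"
        using 1 Suc by simp
      also have "(exp (- 1 / x) * (1 / x\<^sup>2) * x ^ k - exp (- 1 / x) * (real k * x ^ m)) / (x ^ k * x ^ k)
          = exp (- 1 / x) * (1 / x\<^sup>2) / x ^ k - exp (- 1 / x) * real k * (x ^ m / (x ^ k * x ^ k))"
        using 1 by (simp add: diff_divide_distrib)
      also have "x ^ m / (x ^ k * x ^ k) = 1 / x ^ (k + 1)"
        using 1 Suc by simp
      also have "exp (- 1 / x) * (1 / x\<^sup>2) / x ^ k - exp (- 1 / x) * real k * (1 / x ^ (k + 1))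
          = flat (k + 2) x - real k * flat (k + 1) x"
        using 1 by (simp add: flat_def power_add power2_eq_square ac_simps)
      finally show ?thesis .
    qed
    then show ?thesis
      by (rule has_field_derivative_transform_within_open[where S = "{0<..}"])
         (use 1 in \<open>simp_all add: flat_def\<close>)
  next
    case 2
    have "((\<lambda>x. 0) has_real_derivative flat (k + 2) x - real k * flat (k + 1) x) (at x)"
      using 2 by (simp add: flat_def)
    then show ?thesis
      by (rule has_field_derivative_transform_within_open[where S = "{..<0}"])
         (use 2 in \<open>simp_all add: flat_def\<close>)
  qed
qed

lemma times_differentiable_flat: "times_differentiable n (flat k)"
proof (induction n arbitrary: k)
  case (Suc n)
  show ?case
    by (rule times_differentiable_SucI[OF has_real_derivative_flat])
       (intro times_differentiable_diff times_differentiable_mult times_differentiable_const Suc)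
qed simp

lemma flat_nonneg: "flat k x \<ge> 0"
  by (simp add: flat_def)

lemma flat_pos_iff: "flat k x > 0 \<longleftrightarrow> x > 0"
  by (simp add: flat_def)

lemma continuous_flat: "continuous_on A (flat k)"
  by (meson DERIV_continuous_on has_real_derivative_flat has_field_derivative_at_within)

section \<open>The smooth step and its derivative\<close>

text \<open>The standard smooth transition from 0 to 1 across \<open>[0, 1]\<close>. The denominator
  is positive because \<open>x\<close> or \<open>1 - x\<close> is.\<close>

definition smooth_step :: "real \<Rightarrow> real" where
  "smooth_step x = flat 0 x / (flat 0 x + flat 0 (1 - x))"

text \<open>The quotient rule after cancelling \<open>flat 2 x * flat 0 x\<close>. The result is a
  continuous bump supported in \<open>[0, 1]\<close> with integral 1, which serves as a mollifier
  kernel.\<close>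

definition smooth_step_deriv :: "real \<Rightarrow> real" where
  "smooth_step_deriv x =
     (flat 2 x * flat 0 (1 - x) + flat 0 x * flat 2 (1 - x)) / (flat 0 x + flat 0 (1 - x))\<^sup>2"

lemma smooth_step_denom_pos: "flat 0 x + flat 0 (1 - x) > 0"
  using flat_nonneg[of 0 x] flat_nonneg[of 0 "1 - x"] flat_pos_iff[of 0 x] flat_pos_iff[of 0 "1 - x"]
  by linarith

lemma has_real_derivative_smooth_step:
  "(smooth_step has_real_derivative smooth_step_deriv x) (at x)"
proof -
  have d0: "(flat 0 has_real_derivative flat 2 x) (at x)" for x
    using has_real_derivative_flat[of 0 x] by (simp add: numeral_2_eq_2)
  have d1: "((\<lambda>x. flat 0 (1 - x)) has_real_derivative flat 2 (1 - x) * (-1)) (at x)"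
    by (rule DERIV_chain2[OF d0]) (auto intro!: derivative_eq_intros)
  have nz: "flat 0 x + flat 0 (1 - x) \<noteq> 0"
    using smooth_step_denom_pos[of x] by simp
  have "((\<lambda>x. flat 0 x / (flat 0 x + flat 0 (1 - x))) has_real_derivative
      (flat 2 x * (flat 0 x + flat 0 (1 - x)) - flat 0 x * (flat 2 x + flat 2 (1 - x) * (-1)))
        / ((flat 0 x + flat 0 (1 - x)) * (flat 0 x + flat 0 (1 - x)))) (at x)"
    by (rule DERIV_divide[OF d0 DERIV_add[OF d0 d1] nz])
  also have "flat 2 x * (flat 0 x + flat 0 (1 - x)) - flat 0 x * (flat 2 x + flat 2 (1 - x) * (-1))
      = flat 2 x * flat 0 (1 - x) + flat 0 x * flat 2 (1 - x)"
    by (simp add: algebra_simps)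
  finally show ?thesis
    by (simp add: smooth_step_def [abs_def] smooth_step_deriv_def power2_eq_square)
qed

lemma times_differentiable_smooth_step: "times_differentiable n smooth_step"
proof -
  have "times_differentiable n (\<lambda>x. flat 0 (1 - x))"
    using times_differentiable_affine[OF times_differentiable_flat, of n 0 "-1" 1] by simp
  moreover have "flat 0 x + flat 0 (1 - x) \<noteq> 0" for x
    using smooth_step_denom_pos[of x] by simp
  ultimately show ?thesis
    unfolding smooth_step_def [abs_def] divide_inverse
    by (intro times_differentiable_mult times_differentiable_inverse times_differentiable_add
        times_differentiable_flat)
qed

lemma smooth_step_eq_0: "x \<le> 0 \<Longrightarrow> smooth_step x = 0"
  by (simp add: smooth_step_def flat_def)

lemma smooth_step_eq_1: "x \<ge> 1 \<Longrightarrow> smooth_step x = 1"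
  by (simp add: smooth_step_def flat_def)

lemma smooth_step_bounds: "0 \<le> smooth_step x" "smooth_step x \<le> 1"
  using smooth_step_denom_pos[of x] flat_nonneg[of 0 x] flat_nonneg[of 0 "1 - x"]
  by (auto simp: smooth_step_def divide_simps)

lemma smooth_step_deriv_eq_0: "x \<notin> {0..1} \<Longrightarrow> smooth_step_deriv x = 0"
  by (auto simp: smooth_step_deriv_def flat_def)

lemma continuous_smooth_step_deriv: "continuous_on A smooth_step_deriv"
proof -
  have "continuous_on A (\<lambda>x. flat k (1 - x))" for k
    by (intro continuous_on_compose2[OF continuous_flat[of UNIV]] continuous_intros) auto
  moreover have "flat 0 x + flat 0 (1 - x) \<noteq> 0" for x
    using smooth_step_denom_pos[of x] by simp
  ultimately show ?thesis
    unfolding smooth_step_deriv_def [abs_def]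
    by (intro continuous_intros continuous_flat) auto
qed

section \<open>Integrals of weak derivatives\<close>

lemma test_fun_onI:
  assumes smooth: "\<And>n. times_differentiable n \<phi>"
    and supp: "\<And>x. \<phi> x \<noteq> 0 \<Longrightarrow> x \<in> {c..d}" and "a < c" "d < b"
  shows "test_fun_on a b \<phi>"
proof -
  have sub: "closure {x. \<phi> x \<noteq> 0} \<subseteq> {c..d}"
    using supp by (intro closure_minimal) auto
  then have "compact (closure {x. \<phi> x \<noteq> 0})"
    by (meson bounded_closed_interval bounded_subset closed_closure compact_eq_bounded_closed)
  then show ?thesis
    unfolding test_fun_on_def
    using sub times_differentiable_funpow_deriv[OF smooth] \<open>a < c\<close> \<open>d < b\<close> by fastforce
qed

lemma LINT_smooth_step_deriv: "(LINT s:{0..1}|lebesgue. smooth_step_deriv s) = 1"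
proof -
  have "(smooth_step_deriv has_integral (smooth_step 1 - smooth_step 0)) {0..1}"
    by (intro fundamental_theorem_of_calculus)
       (auto intro: has_real_derivative_smooth_step has_field_derivative_at_within
             simp flip: has_real_derivative_iff_has_vector_derivative)
  moreover have "set_integrable lebesgue {0..1} smooth_step_deriv"
    by (intro absolutely_integrable_continuous_real continuous_smooth_step_deriv)
  ultimately show ?thesis
    by (simp add: set_lebesgue_integral_eq_integral integral_unique smooth_step_eq_0 smooth_step_eq_1)
qed

text \<open>The rescaled kernel lives on \<open>[x, x + e n]\<close>. Substituting
  \<open>t = x + e n * s\<close> moves it to the fixed interval \<open>[0, 1]\<close>; dominated
  convergence and continuity of \<open>w\<close> at \<open>x\<close> then give the limit, since the
  kernel has integral 1.\<close>

lemma LINT_mult_smooth_step_deriv_tendsto: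
  fixes w :: "real \<Rightarrow> real"
  assumes cont: "continuous_on {a..b} w" and "a < x"
    and e: "\<And>n. 0 < e n" "\<And>n. x + e n < b" "e \<longlonglongrightarrow> 0"
  shows "(\<lambda>n. LINT t:{a<..<b}|lebesgue. w t * (smooth_step_deriv ((t - x) / e n) / e n)) \<longlonglongrightarrow> w x"
proof -
  \<comment> \<open>The support of the rescaled kernel stays inside \<open>(a, b)\<close>, so the
    indicator of \<open>(a, b)\<close> is 1 wherever the kernel is nonzero.\<close>
  have in_ab: "x + e n * s \<in> {a<..<b}" if "s \<in> {0..1}" for n s
  proof -
    have "0 \<le> e n * s" "e n * s \<le> e n"
      using e(1)[of n] that by (auto simp: mult_left_le)
    then show ?thesis
      using \<open>a < x\<close> e(2)[of n] by simp
  qed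
  have in_Icc: "x + e n * s \<in> {a..b}" if "s \<in> {0..1}" for n s
    using in_ab[OF that, of n] by simp
  have subst: "(LINT t:{a<..<b}|lebesgue. w t * (smooth_step_deriv ((t - x) / e n) / e n))
      = (LINT s:{0..1}|lebesgue. w (x + e n * s) * smooth_step_deriv s)" for n
  proof -
    \<comment> \<open>The explicit indicator turns this into a substitution on the whole line; its
      Jacobian \<open>e n\<close> cancels the factor \<open>1 / e n\<close>.\<close>
    let ?f = "\<lambda>t. indicat_real {a<..<b} t * (w t * (smooth_step_deriv ((t - x) / e n) / e n))"
    have "(LINT t|lebesgue. ?f t) = \<bar>e n\<bar> *\<^sub>R (LINT s|lebesgue. ?f (x + e n * s))"
      using e(1)[of n] by (intro lebesgue_integral_real_affine) simp
    also have "\<dots> = (LINT s|lebesgue. e n * ?f (x + e n * s))"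
      using e(1)[of n] by simp
    also have "\<dots> = (LINT s|lebesgue. indicat_real {0..1} s * (w (x + e n * s) * smooth_step_deriv s))"
    proof (rule Bochner_Integration.integral_cong[OF refl])
      fix s
      show "e n * ?f (x + e n * s) = indicat_real {0..1} s * (w (x + e n * s) * smooth_step_deriv s)"
        using e(1)[of n] in_ab[of s n] smooth_step_deriv_eq_0[of s] by (cases "s \<in> {0..1}") simp_all
    qed
    finally show ?thesis
      by (simp add: set_lebesgue_integral_def)
  qed
  obtain M where M: "\<forall>t\<in>{a..b}. \<bar>w t\<bar> \<le> M"
    using compact_imp_bounded[OF compact_continuous_image[OF cont compact_Icc]]
    unfolding bounded_iff by auto
  have D: "set_integrable lebesgue {0..1} smooth_step_deriv"
    by (intro absolutely_integrable_continuous_real continuous_smooth_step_deriv)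
  have w_cont: "isCont w x"
  proof (rule continuous_on_interior[OF cont])
    show "x \<in> interior {a..b}"
      using \<open>a < x\<close> e(1,2)[of 0] by simp
  qed
  have "(\<lambda>n. LINT s:{0..1}|lebesgue. w (x + e n * s) * smooth_step_deriv s)
      \<longlonglongrightarrow> (LINT s:{0..1}|lebesgue. w x * smooth_step_deriv s)"
    unfolding set_lebesgue_integral_def
  proof (rule integral_dominated_convergence[where w = "\<lambda>s. M * \<bar>indicator {0..1} s *\<^sub>R smooth_step_deriv s\<bar>"])
    show "(\<lambda>s. indicat_real {0..1} s *\<^sub>R (w x * smooth_step_deriv s)) \<in> borel_measurable lebesgue"
      using set_integrable_mult_right[OF D, of "w x"]
      unfolding set_integrable_def by (rule borel_measurable_integrable)
    show "(\<lambda>s. indicat_real {0..1} s *\<^sub>R (w (x + e n * s) * smooth_step_deriv s)) \<in> borel_measurable lebesgue" for n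
    proof -
      have "continuous_on {0..1} (\<lambda>s. w (x + e n * s))"
        by (rule continuous_on_compose2[OF cont], intro continuous_intros, intro image_subsetI in_Icc)
      then have "set_integrable lebesgue {0..1} (\<lambda>s. w (x + e n * s) * smooth_step_deriv s)"
        by (intro absolutely_integrable_continuous_real continuous_intros continuous_smooth_step_deriv)
      then show ?thesis
        unfolding set_integrable_def by (rule borel_measurable_integrable)
    qed
    show "integrable lebesgue (\<lambda>s. M * \<bar>indicator {0..1} s *\<^sub>R smooth_step_deriv s\<bar>)"
      using D unfolding set_integrable_def by (intro integrable_mult_right integrable_abs)
    show "AE s in lebesgue. (\<lambda>n. indicator {0..1} s *\<^sub>R (w (x + e n * s) * smooth_step_deriv s))
        \<longlonglongrightarrow> indicator {0..1} s *\<^sub>R (w x * smooth_step_deriv s)"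
    proof (rule AE_I2)
      fix s :: real
      have "(\<lambda>n. x + e n * s) \<longlonglongrightarrow> x + 0 * s"
        by (intro tendsto_intros e)
      then have "(\<lambda>n. w (x + e n * s)) \<longlonglongrightarrow> w x"
        by (intro isCont_tendsto_compose[OF w_cont]) simp
      then show "(\<lambda>n. indicator {0..1} s *\<^sub>R (w (x + e n * s) * smooth_step_deriv s))
          \<longlonglongrightarrow> indicator {0..1} s *\<^sub>R (w x * smooth_step_deriv s)"
        by (intro tendsto_intros)
    qed
    show "AE s in lebesgue. norm (indicator {0..1} s *\<^sub>R (w (x + e n * s) * smooth_step_deriv s))
        \<le> M * \<bar>indicator {0..1} s *\<^sub>R smooth_step_deriv s\<bar>" for n
    proof (rule AE_I2)
      fix s :: real
      show "norm (indicator {0..1} s *\<^sub>R (w (x + e n * s) * smooth_step_deriv s))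
          \<le> M * \<bar>indicator {0..1} s *\<^sub>R smooth_step_deriv s\<bar>"
      proof (cases "s \<in> {0..1}")
        case True
        then have "\<bar>w (x + e n * s)\<bar> \<le> M"
          using M in_Icc by blast
        then show ?thesis
          using True by (simp add: abs_mult mult_right_mono)
      qed simp
    qed
  qed
  then show ?thesis
    unfolding subst by (simp add: LINT_smooth_step_deriv)
qed

lemma set_integrable_mult_bounded:
  fixes f h :: "real \<Rightarrow> real"
  assumes f: "set_integrable lebesgue S f" and h: "continuous_on UNIV h"
    and bound: "\<And>t. t \<in> S \<Longrightarrow> \<bar>h t\<bar> \<le> M"
  shows "set_integrable lebesgue S (\<lambda>t. f t * h t)"
  unfolding set_integrable_def
proof (rule Bochner_Integration.integrable_bound)
  show "integrable lebesgue (\<lambda>t. M * (indicator S t *\<^sub>R f t))"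
    using f unfolding set_integrable_def by (intro integrable_mult_right)
  have "h \<in> borel_measurable lebesgue"
    using borel_measurable_continuous_onI[OF h] by (intro measurable_completion) simp
  moreover have "(\<lambda>t. indicator S t *\<^sub>R f t) \<in> borel_measurable lebesgue"
    using f unfolding set_integrable_def by (rule borel_measurable_integrable)
  ultimately have "(\<lambda>t. (indicator S t *\<^sub>R f t) * h t) \<in> borel_measurable lebesgue"
    by (intro borel_measurable_times)
  then show "(\<lambda>t. indicator S t *\<^sub>R (f t * h t)) \<in> borel_measurable lebesgue"
    by (simp add: mult.assoc)
  show "AE t in lebesgue. norm (indicator S t *\<^sub>R (f t * h t)) \<le> norm (M * (indicator S t *\<^sub>R f t))"
  proof (rule AE_I2)
    fix t
    show "norm (indicator S t *\<^sub>R (f t * h t)) \<le> norm (M * (indicator S t *\<^sub>R f t))"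
    proof (cases "t \<in> S")
      case True
      then have "\<bar>h t\<bar> \<le> \<bar>M\<bar>"
        using bound by force
      then show ?thesis
        using True by (simp add: abs_mult mult.commute[of "\<bar>f t\<bar>"] mult_right_mono)
    qed simp
  qed
qed

section \<open>The fundamental theorem for weak derivatives\<close>

text \<open>The derivative of the test function \<open>\<phi> n\<close> is a kernel at
  \<open>x\<close> minus a kernel at \<open>y\<close>, so the two sides of the weak identity
  converge to the integral of \<open>g\<close> and to \<open>w y - w x\<close>. The end points are
  interior because test functions have compact support in \<open>(a, b)\<close>.\<close>

lemma weak_derivative_LINT_eq_diff:
  assumes cont: "continuous_on {a..b} w" and weak: "has_weak_derivative_on a b w g"
    and xy: "a < x" "x \<le> y" "y < b"
  shows "(LINT t:{x..y}|lebesgue. g t) = w y - w x"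
proof -
  \<comment> \<open>The midpoint of \<open>y\<close> and \<open>b\<close>: all
    \<open>\<phi> n\<close> are then supported in the one compact set \<open>K\<close>, on which
    \<open>g\<close> is integrable.\<close>
  define c where "c = (y + b) / 2"
  have c: "y < c" "c < b" "c - y = (b - y) / 2"
    using xy by (simp_all add: c_def field_simps)
  \<comment> \<open>The shift by 2 gives \<open>e n \<le> (b - y) / 2 = c - y\<close> already at
    \<open>n = 0\<close>.\<close>
  define e where "e n = (b - y) / real (n + 2)" for n
  have e_pos: "0 < e n" for n
    using xy by (simp add: e_def)
  have e_le: "e n \<le> c - y" for n
    unfolding c(3) using xy unfolding e_def by (intro divide_left_mono) auto
  have e_less: "y + e n < b" "x + e n < b" for n
    using e_le[of n] c xy by auto
  have e_lim: "e \<longlonglongrightarrow> 0"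
    unfolding e_def [abs_def]
    by (rule LIMSEQ_ignore_initial_segment[OF lim_const_over_n])
  define K where "K = {x..c}"
  \<comment> \<open>smooth approximations of the indicator function of \<open>{x<..y}\<close>, used as test functions\<close>
  define \<phi> where "\<phi> n t = smooth_step ((t - x) / e n) - smooth_step ((t - y) / e n)" for n t
  have \<phi>_deriv: "(\<phi> n has_real_derivative smooth_step_deriv ((t - x) / e n) / e n
      - smooth_step_deriv ((t - y) / e n) / e n) (at t)" for n t
  proof -
    have "((\<lambda>t. smooth_step ((t - z) / e n)) has_real_derivative
        smooth_step_deriv ((t - z) / e n) * (1 / e n)) (at t)" for z
      by (rule DERIV_chain2[OF has_real_derivative_smooth_step])
         (use e_pos[of n] in \<open>auto intro!: derivative_eq_intros\<close>)
    from DERIV_diff[OF this this] show ?thesis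
      by (simp add: \<phi>_def [abs_def])
  qed
  \<comment> \<open>Left of \<open>x\<close> both steps are 0, and right of \<open>y + e n\<close>
    both are 1 and cancel.\<close>
  have \<phi>_supp: "t \<in> K" if "\<phi> n t \<noteq> 0" for n t
  proof (rule ccontr)
    assume "t \<notin> K"
    then have "t < x \<or> t > y + e n"
      using e_le[of n] unfolding K_def atLeastAtMost_iff by linarith
    then show False
    proof
      assume "t < x"
      then show False
        using that xy e_pos[of n] by (simp add: \<phi>_def smooth_step_eq_0 divide_nonpos_pos)
    next
      assume "t > y + e n"
      then show False
        using that xy e_pos[of n] by (simp add: \<phi>_def smooth_step_eq_1 le_divide_eq)
    qed
  qed
  have \<phi>_bound: "\<bar>\<phi> n t\<bar> \<le> 1" for n t
    using smooth_step_bounds[of "(t - x) / e n"] smooth_step_bounds[of "(t - y) / e n"]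
    by (simp add: \<phi>_def)
  have \<phi>_test: "test_fun_on a b (\<phi> n)" for n
  proof (rule test_fun_onI[where c = x and d = "c"])
    fix m
    have "times_differentiable m (\<lambda>t. smooth_step ((t - z) / e n))" for z
      using times_differentiable_affine[OF times_differentiable_smooth_step, of m "1 / e n" "- z / e n"]
      by (simp add: diff_divide_distrib)
    then show "times_differentiable m (\<phi> n)"
      unfolding \<phi>_def [abs_def] by (intro times_differentiable_diff)
  qed (use xy c \<phi>_supp in \<open>auto simp: K_def\<close>)
  have K: "compact K" "K \<subseteq> {a<..<b}"
    using xy c by (auto simp: K_def)
  then have g_K: "set_integrable lebesgue K g"
    using weak by (simp add: has_weak_derivative_on_def locally_integrable_on_def)

  have "(\<lambda>n. LINT t:K|lebesgue. g t * \<phi> n t) \<longlonglongrightarrow> (LINT t:{x..y}|lebesgue. g t)"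
    unfolding set_lebesgue_integral_def
  proof (rule integral_dominated_convergence[where w = "\<lambda>t. \<bar>indicator K t *\<^sub>R g t\<bar>"])
    show "integrable lebesgue (\<lambda>t. \<bar>indicator K t *\<^sub>R g t\<bar>)"
      using g_K by (simp add: set_integrable_def integrable_abs)
    have "set_integrable lebesgue {x..y} g"
      using c by (intro set_integrable_subset[OF g_K]) (auto simp: K_def)
    then show "(\<lambda>t. indicator {x..y} t *\<^sub>R g t) \<in> borel_measurable lebesgue"
      unfolding set_integrable_def by (rule borel_measurable_integrable)
    have cont_\<phi>: "continuous_on UNIV (\<phi> n)" for n
      using \<phi>_deriv by (rule DERIV_continuous_on)
    show "(\<lambda>t. indicator K t *\<^sub>R (g t * \<phi> n t)) \<in> borel_measurable lebesgue" for n
      using set_integrable_mult_bounded[OF g_K cont_\<phi> \<phi>_bound]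
      unfolding set_integrable_def by (rule borel_measurable_integrable)
    show "AE t in lebesgue. norm (indicator K t *\<^sub>R (g t * \<phi> n t)) \<le> \<bar>indicator K t *\<^sub>R g t\<bar>" for n
      using \<phi>_bound[of n] by (intro AE_I2) (auto simp: abs_mult mult_left_le split: split_indicator)
    have step_lim: "(\<lambda>n. smooth_step ((t - z) / e n)) \<longlonglongrightarrow> (if t \<le> z then 0 else 1)" for t z
    proof (cases "t \<le> z")
      case True
      then have "smooth_step ((t - z) / e n) = 0" for n
        using e_pos[of n] by (intro smooth_step_eq_0 divide_nonpos_pos) auto
      then show ?thesis
        using True by simp
    next
      case False
      then have "eventually (\<lambda>n. e n < t - z) sequentially"
        by (intro order_tendstoD(2)[OF e_lim]) simp
      then have "eventually (\<lambda>n. smooth_step ((t - z) / e n) = 1) sequentially"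
        by eventually_elim (use e_pos in \<open>auto intro!: smooth_step_eq_1 simp: le_divide_eq\<close>)
      then show ?thesis
        using False by (simp add: tendsto_eventually)
    qed
    \<comment> \<open>The limit of \<open>\<phi> n\<close> is the indicator of
      \<open>{x<..y}\<close>, because the step at \<open>z\<close> has limit 0 at
      \<open>t = z\<close>. It differs from that of \<open>{x..y}\<close> only at the null point
      \<open>x\<close>.\<close>
    have "(\<lambda>n. indicator K t *\<^sub>R (g t * \<phi> n t)) \<longlonglongrightarrow> indicator {x..y} t *\<^sub>R g t" if "t \<noteq> x" for t
    proof -
      have "(\<lambda>n. indicator K t *\<^sub>R (g t * \<phi> n t))
          \<longlonglongrightarrow> indicator K t *\<^sub>R (g t * ((if t \<le> x then 0 else 1) - (if t \<le> y then 0 else 1)))"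
        unfolding \<phi>_def by (intro tendsto_intros step_lim)
      also have "indicator K t *\<^sub>R (g t * ((if t \<le> x then 0 else 1) - (if t \<le> y then 0 else 1)))
          = indicator {x..y} t *\<^sub>R g t"
        using that xy c by (auto simp: K_def split: split_indicator)
      finally show ?thesis .
    qed
    then show "AE t in lebesgue. (\<lambda>n. indicator K t *\<^sub>R (g t * \<phi> n t)) \<longlonglongrightarrow> indicator {x..y} t *\<^sub>R g t"
      using AE_completion[OF AE_lborel_singleton[of x]] by (auto elim!: eventually_mono)
  qed
  moreover have "(LINT t:K|lebesgue. g t * \<phi> n t)
      = - (LINT t:{a<..<b}|lebesgue. w t * (smooth_step_deriv ((t - x) / e n) / e n))
        + (LINT t:{a<..<b}|lebesgue. w t * (smooth_step_deriv ((t - y) / e n) / e n))" for n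
  proof -
    have int: "set_integrable lebesgue {a<..<b} (\<lambda>t. w t * (smooth_step_deriv ((t - z) / e n) / e n))" for z
    proof (rule set_integrable_subset)
      show "set_integrable lebesgue {a..b} (\<lambda>t. w t * (smooth_step_deriv ((t - z) / e n) / e n))"
        using e_pos[of n]
        by (intro absolutely_integrable_continuous_real continuous_intros cont
            continuous_on_compose2[OF continuous_smooth_step_deriv[of UNIV]]) auto
    qed auto
    have "(LINT t:K|lebesgue. g t * \<phi> n t) = (LINT t:{a<..<b}|lebesgue. g t * \<phi> n t)"
      unfolding set_lebesgue_integral_def using K(2) \<phi>_supp
      by (intro Bochner_Integration.integral_cong) (auto split: split_indicator)
    also have "\<dots> = - (LINT t:{a<..<b}|lebesgue. w t * deriv (\<phi> n) t)"
      using weak \<phi>_test[of n] by (simp add: has_weak_derivative_on_def)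
    also have "deriv (\<phi> n) = (\<lambda>t. smooth_step_deriv ((t - x) / e n) / e n
        - smooth_step_deriv ((t - y) / e n) / e n)"
      using \<phi>_deriv by (intro ext DERIV_imp_deriv)
    finally show ?thesis
      using set_integral_diff(2)[OF int int, of x y] by (simp add: right_diff_distrib)
  qed
  moreover have "(\<lambda>n. - (LINT t:{a<..<b}|lebesgue. w t * (smooth_step_deriv ((t - x) / e n) / e n))
        + (LINT t:{a<..<b}|lebesgue. w t * (smooth_step_deriv ((t - y) / e n) / e n)))
      \<longlonglongrightarrow> - w x + w y"
    using xy by (intro tendsto_add tendsto_minus LINT_mult_smooth_step_deriv_tendsto[OF cont] e_pos e_less e_lim) auto
  ultimately show ?thesis
    using LIMSEQ_unique by fastforce
qed

section \<open>Almost everywhere uniqueness of weak derivatives\<close>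

text \<open>Vanishing of the integral passes from closed intervals to all Borel sets, by complements
  and countable disjoint unions; a function with zero integral over every Borel set vanishes almost
  everywhere.\<close>

lemma AE_eq_0_if_LINT_Icc_eq_0:
  fixes f :: "real \<Rightarrow> real"
  assumes f: "integrable lebesgue f"
    and Icc: "\<And>x y. x \<le> y \<Longrightarrow> (LINT t:{x..y}|lebesgue. f t) = 0"
  shows "AE t in lebesgue. f t = 0"
proof -
  \<comment> \<open>Borel induction needs a Borel function, so the Lebesgue measurable
    \<open>f\<close> is replaced by a Borel version.\<close>
  obtain f0 where f0 [measurable]: "f0 \<in> borel_measurable lborel" and eq: "AE t in lborel. f t = f0 t"
    using completion_ex_borel_measurable_real[of f lborel] borel_measurable_integrable[OF f] by auto
  have eq': "AE t in lebesgue. f t = f0 t"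
    using eq by (rule AE_completion)
  have f0_leb: "f0 \<in> borel_measurable lebesgue"
    using f0 by (rule measurable_completion)
  have "integrable lebesgue f0"
    using f f0_leb eq' by (subst integrable_cong_AE[symmetric]) auto
  then have f0_int: "integrable lborel f0"
    using f0 by (simp add: integrable_completion)
  have set_int: "set_integrable lborel A f0" if "A \<in> sets borel" for A
    using f0_int that unfolding set_integrable_def by (intro integrable_mult_indicator) auto
  have f0_Icc: "(LINT t:{x..y}|lborel. f0 t) = 0" if "x \<le> y" for x y
  proof -
    have "(LINT t:{x..y}|lborel. f0 t) = (LINT t:{x..y}|lebesgue. f0 t)"
      unfolding set_lebesgue_integral_def by (subst integral_completion) auto
    also have "\<dots> = (LINT t:{x..y}|lebesgue. f t)"
      unfolding set_lebesgue_integral_def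
    proof (rule integral_cong_AE)
      show "(\<lambda>t. indicator {x..y} t *\<^sub>R f t) \<in> borel_measurable lebesgue"
        using borel_measurable_integrable[OF f] by (intro borel_measurable_scaleR borel_measurable_indicator) auto
      show "(\<lambda>t. indicator {x..y} t *\<^sub>R f0 t) \<in> borel_measurable lebesgue"
        by (intro borel_measurable_scaleR borel_measurable_indicator f0_leb) auto
      show "AE t in lebesgue. indicator {x..y} t *\<^sub>R f0 t = indicator {x..y} t *\<^sub>R f t"
        using eq' by eventually_elim simp
    qed
    finally show ?thesis
      using Icc[OF that] by simp
  qed
  \<comment> \<open>The complement case needs the integral over the whole line, obtained by
    exhausting it with \<open>[-n, n]\<close>.\<close>
  have f0_UNIV: "(LINT t:UNIV|lborel. f0 t) = 0"
  proof -
    have UN: "(\<Union>n. {- real n..real n}) = UNIV"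
    proof -
      have "\<exists>n. t \<in> {- real n..real n}" for t
        using real_arch_simple[of "\<bar>t\<bar>"] by (auto simp: abs_le_iff minus_le_iff)
      then show ?thesis
        by blast
    qed
    have "(\<lambda>n. LINT t:{- real n..real n}|lborel. f0 t) \<longlonglongrightarrow> (LINT t:(\<Union>n. {- real n..real n})|lborel. f0 t)"
      by (intro set_integral_cont_up set_int) (auto simp: incseq_def)
    then show ?thesis
      using UN f0_Icc by (simp add: LIMSEQ_const_iff)
  qed
  have "(LINT t:A|lborel. f0 t) = 0" if "A \<in> sets borel" for A
    using that
  proof (induction rule: borel_set_induct)
    case empty
    then show ?case by (simp add: set_lebesgue_integral_def)
  next
    case (interval x y)
    then show ?case by (rule f0_Icc)
  next
    case (compl A)
    have "(LINT t:A \<union> - A|lborel. f0 t) = (LINT t:A|lborel. f0 t) + (LINT t:- A|lborel. f0 t)"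
      using compl.hyps by (intro set_integral_Un set_int) auto
    then show ?case
      using compl f0_UNIV by simp
  next
    case (union A)
    then have "(LINT t:(\<Union>i. A i)|lborel. f0 t) = (\<Sum>i. LINT t:A i|lborel. f0 t)"
      by (intro lebesgue_integral_countable_add set_int) (auto simp: disjoint_family_on_def)
    then show ?case
      using union by simp
  qed
  then have "AE t in lborel. f0 t = 0"
    by (intro sigma_finite_measure.density_zero[OF lborel.sigma_finite_measure_axioms] f0_int) auto
  from AE_completion[OF this] eq' show ?thesis
    by eventually_elim simp
qed

text \<open>Over interior intervals \<open>g\<close> and \<open>h\<close> both integrate to
  increments of \<open>w\<close>. Local integrability restricts the argument to compact
  subintervals, countably many of which exhaust \<open>(a, b)\<close>.\<close>

lemma weak_derivative_unique:
  assumes cont: "continuous_on {a..b} w"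
    and g: "has_weak_derivative_on a b w g" and h: "has_weak_derivative_on a b w h"
  shows "AE t in lebesgue. t \<in> {a<..<b} \<longrightarrow> g t = h t"
proof -
  have local: "AE t in lebesgue. t \<in> {c..d} \<longrightarrow> g t = h t" if cd: "a < c" "d < b" for c d
  proof -
    have int: "set_integrable lebesgue {c..d} g" "set_integrable lebesgue {c..d} h"
      using g h cd by (simp_all add: has_weak_derivative_on_def locally_integrable_on_def subset_iff)
    let ?f = "\<lambda>t. indicator {c..d} t *\<^sub>R (g t - h t)"
    have "AE t in lebesgue. ?f t = 0"
    proof (rule AE_eq_0_if_LINT_Icc_eq_0)
      show "integrable lebesgue ?f"
        using set_integral_diff(1)[OF int] by (simp add: set_integrable_def)
      fix x y :: real
      \<comment> \<open>Intersecting \<open>[x, y]\<close> with \<open>[c, d]\<close> gives an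
        interior interval or the empty set.\<close>
      have "(LINT t:{x..y}|lebesgue. ?f t) = (LINT t:{max x c..min y d}|lebesgue. g t - h t)"
        unfolding set_lebesgue_integral_def
        by (intro Bochner_Integration.integral_cong) (auto split: split_indicator)
      also have "\<dots> = 0"
      proof (cases "max x c \<le> min y d")
        case True
        have "set_integrable lebesgue {max x c..min y d} g" "set_integrable lebesgue {max x c..min y d} h"
          by (rule set_integrable_subset[OF int(1)] set_integrable_subset[OF int(2)]; simp)+
        moreover have "(LINT t:{max x c..min y d}|lebesgue. g t) = (LINT t:{max x c..min y d}|lebesgue. h t)"
          using True cd
          by (simp add: weak_derivative_LINT_eq_diff[OF cont g] weak_derivative_LINT_eq_diff[OF cont h]
              less_max_iff_disj min_less_iff_disj)
        ultimately show ?thesis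
          by simp
      next
        case False
        then have "{max x c..min y d} = {}"
          by simp
        then show ?thesis
          by (simp only: set_lebesgue_integral_def) simp
      qed
      finally show "(LINT t:{x..y}|lebesgue. ?f t) = 0" .
    qed
    then show ?thesis
      by eventually_elim auto
  qed
  have "AE t in lebesgue. \<forall>n. t \<in> {a + 1 / real (Suc n)..b - 1 / real (Suc n)} \<longrightarrow> g t = h t"
    unfolding AE_all_countable by (intro allI local) auto
  then show ?thesis
  proof eventually_elim
    case (elim t)
    show ?case
    proof
      assume "t \<in> {a<..<b}"
      then obtain n where "1 / real (Suc n) < min (t - a) (b - t)"
        using reals_Archimedean[of "min (t - a) (b - t)"] by (auto simp: inverse_eq_divide)
      then show "g t = h t"
        using elim[rule_format, of n] by auto
    qed
  qed
qed

section \<open>The weighted inequality\<close>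

text \<open>The integral of \<open>(f x + s * g x)\<^sup>2\<close> is a quadratic polynomial in
  \<open>s\<close> that is never negative.\<close>

lemma Cauchy_Schwarz_LINT:
  fixes f g :: "'a \<Rightarrow> real"
  assumes f: "integrable M (\<lambda>x. (f x)\<^sup>2)" and g: "integrable M (\<lambda>x. (g x)\<^sup>2)"
    and fg: "integrable M (\<lambda>x. f x * g x)"
  shows "(LINT x|M. f x * g x)\<^sup>2 \<le> (LINT x|M. (f x)\<^sup>2) * (LINT x|M. (g x)\<^sup>2)"
proof -
  define P Q R where "P = (LINT x|M. (f x)\<^sup>2)" and "Q = (LINT x|M. (g x)\<^sup>2)" and "R = (LINT x|M. f x * g x)"
  have quad: "0 \<le> P + 2 * s * R + s\<^sup>2 * Q" for s
  proof -
    have "0 \<le> (LINT x|M. (f x + s * g x)\<^sup>2)"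
      by simp
    also have "\<dots> = (LINT x|M. (f x)\<^sup>2 + (2 * s) * (f x * g x) + s\<^sup>2 * (g x)\<^sup>2)"
      by (intro Bochner_Integration.integral_cong) (auto simp: power2_eq_square algebra_simps)
    also have "\<dots> = P + 2 * s * R + s\<^sup>2 * Q"
      using f g fg by (simp add: P_def Q_def R_def)
    finally show ?thesis .
  qed
  have "P \<ge> 0" "Q \<ge> 0"
    by (simp_all add: P_def Q_def)
  have "R\<^sup>2 \<le> P * Q"
  proof (cases "Q = 0")
    case True
    \<comment> \<open>For \<open>Q = 0\<close> the polynomial is affine in \<open>s\<close>; if
      \<open>R\<close> were nonzero, \<open>s = - (P + 1) / R\<close> would give the value
      \<open>- P - 2 < 0\<close>.\<close>
    have "R = 0"
    proof (rule ccontr)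
      assume "R \<noteq> 0"
      then show False
        using quad[of "- (P + 1) / R"] True \<open>P \<ge> 0\<close> by simp
    qed
    then show ?thesis
      using True by simp
  next
    case False
    \<comment> \<open>The minimiser \<open>s = - R / Q\<close>, with the inequality scaled by
      \<open>Q\<close>.\<close>
    have "0 \<le> Q * (P + 2 * (- R / Q) * R + (- R / Q)\<^sup>2 * Q)"
      by (rule mult_nonneg_nonneg[OF \<open>Q \<ge> 0\<close> quad])
    also have "\<dots> = P * Q - R\<^sup>2"
      using False by (simp add: field_simps power2_eq_square)
    finally show ?thesis
      by simp
  qed
  then show ?thesis
    by (simp add: P_def Q_def R_def)
qed

section \<open>Exchange of exponentially weighted integrals\<close>

lemma set_nn_integral_exp_Ioo_le:
  assumes "lam > 0"
  shows "(\<integral>\<^sup>+y\<in>{a<..<t}. ennreal (exp (lam * y) / lam) \<partial>lborel) \<le> ennreal (exp (lam * t) / lam\<^sup>2)"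
proof (cases "a \<le> t")
  case True
  have "(\<integral>\<^sup>+y\<in>{a<..<t}. ennreal (exp (lam * y) / lam) \<partial>lborel)
      \<le> (\<integral>\<^sup>+y\<in>{a..t}. ennreal (exp (lam * y) / lam) \<partial>lborel)"
    by (intro nn_set_integral_set_mono) auto
  also have "\<dots> = ennreal (exp (lam * t) / lam\<^sup>2 - exp (lam * a) / lam\<^sup>2)"
    using True assms
    by (intro nn_integral_FTC_Icc)
       (auto intro!: derivative_eq_intros simp: power2_eq_square)
  also have "\<dots> \<le> ennreal (exp (lam * t) / lam\<^sup>2)"
    by (intro ennreal_leI) simp
  finally show ?thesis .
qed simp

text \<open>Tonelli on the triangle \<open>a < y < t < b\<close>: for fixed \<open>t\<close> the
  inner integral of \<open>exp (lam * y) / lam\<close> over \<open>(a, t)\<close> is at most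
  \<open>exp (lam * t) / lam\<^sup>2\<close>.\<close>

lemma set_nn_integral_exp_tail_le:
  assumes [measurable]: "Q \<in> borel_measurable borel" and "lam > 0"
  shows "(\<integral>\<^sup>+y\<in>{a<..<b}. (ennreal (exp (lam * y) / lam) * (\<integral>\<^sup>+t\<in>{y<..<b}. Q t \<partial>lborel)) \<partial>lborel)
    \<le> (\<integral>\<^sup>+t\<in>{a<..<b}. (Q t * ennreal (exp (lam * t) / lam\<^sup>2)) \<partial>lborel)"
proof -
  let ?k = "\<lambda>y t. (if a < y \<and> y < t \<and> t < b then ennreal (exp (lam * y) / lam) * Q t else 0)"
  have "(\<integral>\<^sup>+y\<in>{a<..<b}. (ennreal (exp (lam * y) / lam) * (\<integral>\<^sup>+t\<in>{y<..<b}. Q t \<partial>lborel)) \<partial>lborel)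
      = (\<integral>\<^sup>+y. (\<integral>\<^sup>+t. ?k y t \<partial>lborel) \<partial>lborel)"
  proof (rule nn_integral_cong)
    fix y
    have "ennreal (exp (lam * y) / lam) * (\<integral>\<^sup>+t\<in>{y<..<b}. Q t \<partial>lborel) * indicator {a<..<b} y
        = (\<integral>\<^sup>+t. ennreal (exp (lam * y) / lam) * (Q t * indicator {y<..<b} t) * indicator {a<..<b} y \<partial>lborel)"
      by (simp add: nn_integral_cmult nn_integral_multc)
    also have "\<dots> = (\<integral>\<^sup>+t. ?k y t \<partial>lborel)"
      by (intro nn_integral_cong) (auto split: split_indicator)
    finally show "ennreal (exp (lam * y) / lam) * (\<integral>\<^sup>+t\<in>{y<..<b}. Q t \<partial>lborel) * indicator {a<..<b} y
        = (\<integral>\<^sup>+t. ?k y t \<partial>lborel)" .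
  qed
  also have "\<dots> = (\<integral>\<^sup>+t. (\<integral>\<^sup>+y. ?k y t \<partial>lborel) \<partial>lborel)"
    by (intro lborel_pair.Fubini') measurable
  also have "\<dots> \<le> (\<integral>\<^sup>+t\<in>{a<..<b}. (Q t * ennreal (exp (lam * t) / lam\<^sup>2)) \<partial>lborel)"
  proof (rule nn_integral_mono)
    fix t
    have "(\<integral>\<^sup>+y. ?k y t \<partial>lborel)
        = (\<integral>\<^sup>+y. ennreal (exp (lam * y) / lam) * indicator {a<..<t} y * (Q t * indicator {a<..<b} t) \<partial>lborel)"
      by (intro nn_integral_cong) (auto split: split_indicator)
    also have "\<dots> = (\<integral>\<^sup>+y\<in>{a<..<t}. ennreal (exp (lam * y) / lam) \<partial>lborel) * (Q t * indicator {a<..<b} t)"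
      by (intro nn_integral_multc) measurable
    also have "\<dots> \<le> ennreal (exp (lam * t) / lam\<^sup>2) * (Q t * indicator {a<..<b} t)"
      by (intro mult_right_mono set_nn_integral_exp_Ioo_le \<open>lam > 0\<close>) simp
    finally show "(\<integral>\<^sup>+y. ?k y t \<partial>lborel) \<le> Q t * ennreal (exp (lam * t) / lam\<^sup>2) * indicator {a<..<b} t"
      by (simp add: ac_simps)
  qed
  finally show ?thesis .
qed

section \<open>The weighted pointwise bound\<close>

text \<open>Membership in \<open>H1\<close> only provides some square integrable weak derivative; by
  uniqueness the given \<open>w'\<close> agrees with it almost everywhere.\<close>

lemma weak_derivative_set_integrable_square:
  assumes "w \<in> H1 a b" and weak: "has_weak_derivative_on a b w w'"
  shows "set_integrable lebesgue {a<..<b} (\<lambda>t. (w' t)\<^sup>2)"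
proof -
  from \<open>w \<in> H1 a b\<close> obtain g where cont: "continuous_on {a..b} w"
    and g: "g \<in> L2_on a b" "has_weak_derivative_on a b w g"
    by (auto simp: H1_def)
  have eq: "AE t in lebesgue. t \<in> {a<..<b} \<longrightarrow> w' t = g t"
    by (rule weak_derivative_unique[OF cont weak g(2)])
  let ?G = "\<lambda>t. indicator {a<..<b} t *\<^sub>R (g t)\<^sup>2" and ?W = "\<lambda>t. indicator {a<..<b} t *\<^sub>R (w' t)\<^sup>2"
  have G: "integrable lebesgue ?G"
    using g(1) by (simp add: L2_on_def set_integrable_def)
  have ae: "AE t in lebesgue. ?G t = ?W t"
    using eq by eventually_elim (auto split: split_indicator)
  \<comment> \<open>Completeness of Lebesgue measure carries measurability across almost everywhere
    equality.\<close>
  have "?W \<in> borel_measurable lebesgue"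
    by (rule borel_measurable_AE[OF borel_measurable_integrable[OF G] ae])
  then show ?thesis
    unfolding set_integrable_def
    using integrable_cong_AE[OF borel_measurable_integrable[OF G] _ ae] G by blast
qed

lemma set_integrable_mult_continuous:
  fixes f h :: "real \<Rightarrow> real"
  assumes f: "set_integrable lebesgue {a<..<b} f" and h: "continuous_on UNIV h"
  shows "set_integrable lebesgue {a<..<b} (\<lambda>t. f t * h t)"
proof -
  have "compact (h ` {a..b})"
    by (intro compact_continuous_image continuous_on_subset[OF h]) auto
  then obtain M where "\<forall>t\<in>{a..b}. \<bar>h t\<bar> \<le> M"
    using compact_imp_bounded[of "h ` {a..b}"] unfolding bounded_iff by auto
  then show ?thesis
    by (intro set_integrable_mult_bounded[OF f h, of M]) simp
qed

lemma LINT_exp_Icc_le: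
  fixes lam y z :: real
  assumes "lam > 0" "y \<le> z"
  shows "(LINT t:{y..z}|lebesgue. exp (- lam * t)) \<le> exp (- lam * y) / lam"
proof -
  have "((\<lambda>t. exp (- lam * t)) has_integral (- exp (- lam * z) / lam - (- exp (- lam * y) / lam))) {y..z}"
    using assms
    by (intro fundamental_theorem_of_calculus[where f = "\<lambda>t. - exp (- lam * t) / lam"])
       (auto intro!: derivative_eq_intros simp flip: has_real_derivative_iff_has_vector_derivative)
  moreover have "set_integrable lebesgue {y..z} (\<lambda>t. exp (- lam * t))"
    by (intro absolutely_integrable_continuous_real continuous_intros)
  ultimately have "(LINT t:{y..z}|lebesgue. exp (- lam * t))
      = - exp (- lam * z) / lam - (- exp (- lam * y) / lam)"
    by (simp only: set_lebesgue_integral_eq_integral integral_unique)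
  then show ?thesis
    using assms by simp
qed

text \<open>Cauchy-Schwarz for the factorisation of \<open>w' t\<close> into
  \<open>w' t * exp (lam * t / 2)\<close> and \<open>exp (- lam * t / 2)\<close>; the second factor
  contributes at most \<open>exp (- lam * y) / lam\<close>.\<close>

lemma H1_tilde_square_le:
  assumes "lam > 0" and w: "w \<in> H1_tilde a b" and weak: "has_weak_derivative_on a b w w'"
    and y: "a < y" "y < b"
  shows "(w y)\<^sup>2 \<le> exp (- lam * y) / lam * (LINT t:{y<..<b}|lebesgue. (w' t)\<^sup>2 * exp (lam * t))"
proof -
  have cont: "continuous_on {a..b} w" and "w b = 0" and H1: "w \<in> H1 a b"
    using w by (auto simp: H1_tilde_def H1_def)
  define J where "J = (LINT t:{y<..<b}|lebesgue. (w' t)\<^sup>2 * exp (lam * t))"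
  have int: "set_integrable lebesgue {a<..<b} (\<lambda>t. (w' t)\<^sup>2 * exp (lam * t))"
    by (intro set_integrable_mult_continuous weak_derivative_set_integrable_square[OF H1 weak]
        continuous_intros)
  \<comment> \<open>The increment formula holds only at interior points, so the bound is first shown
    for \<open>z < b\<close>, with a right side free of \<open>z\<close>.\<close>
  have bound: "(w z - w y)\<^sup>2 \<le> exp (- lam * y) / lam * J" if z: "y < z" "z < b" for z
  proof -
    let ?f = "\<lambda>t. indicat_real {y..z} t * (w' t * exp (lam * t / 2))"
    let ?g = "\<lambda>t. indicat_real {y..z} t * exp (- lam * t / 2)"
    have f2: "(?f t)\<^sup>2 = indicator {y..z} t *\<^sub>R ((w' t)\<^sup>2 * exp (lam * t))" for t
      by (simp add: power_mult_distrib exp_double[symmetric] split: split_indicator)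
    have g2: "(?g t)\<^sup>2 = indicator {y..z} t *\<^sub>R exp (- lam * t)" for t
      by (simp add: power_mult_distrib exp_double[symmetric] split: split_indicator)
    have fg: "?f t * ?g t = indicator {y..z} t *\<^sub>R w' t" for t
      by (simp add: exp_add[symmetric] split: split_indicator)
    have int_yz: "set_integrable lebesgue {y..z} (\<lambda>t. (w' t)\<^sup>2 * exp (lam * t))"
      using y z by (intro set_integrable_subset[OF int]) auto
    have "(w z - w y)\<^sup>2 = (LINT t|lebesgue. ?f t * ?g t)\<^sup>2"
      using weak_derivative_LINT_eq_diff[OF cont weak, of y z] y z
      unfolding fg by (simp add: set_lebesgue_integral_def)
    also have "\<dots> \<le> (LINT t|lebesgue. (?f t)\<^sup>2) * (LINT t|lebesgue. (?g t)\<^sup>2)"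
    proof (rule Cauchy_Schwarz_LINT)
      show "integrable lebesgue (\<lambda>t. (?f t)\<^sup>2)"
        unfolding f2 using int_yz by (simp add: set_integrable_def)
      have "set_integrable lebesgue {y..z} (\<lambda>t. exp (- lam * t))"
        by (intro absolutely_integrable_continuous_real continuous_intros)
      then show "integrable lebesgue (\<lambda>t. (?g t)\<^sup>2)"
        unfolding g2 by (simp add: set_integrable_def)
      have "{y..z} \<subseteq> {a<..<b}"
        using y z by auto
      then have "set_integrable lebesgue {y..z} w'"
        using weak by (simp add: has_weak_derivative_on_def locally_integrable_on_def)
      then show "integrable lebesgue (\<lambda>t. ?f t * ?g t)"
        unfolding fg by (simp add: set_integrable_def)
    qed
    also have "(LINT t|lebesgue. (?f t)\<^sup>2) = (LINT t:{y..z}|lebesgue. (w' t)\<^sup>2 * exp (lam * t))"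
      unfolding f2 by (simp add: set_lebesgue_integral_def)
    also have "(LINT t|lebesgue. (?g t)\<^sup>2) = (LINT t:{y..z}|lebesgue. exp (- lam * t))"
      unfolding g2 by (simp add: set_lebesgue_integral_def)
    also have "(LINT t:{y..z}|lebesgue. (w' t)\<^sup>2 * exp (lam * t)) \<le> J"
    proof -
      \<comment> \<open>\<open>{y..z}\<close> is contained in \<open>{y<..<b}\<close> except for the
        null point \<open>y\<close>.\<close>
      have "AE t in lebesgue. t \<noteq> y"
        by (rule AE_completion[OF AE_lborel_singleton])
      then show ?thesis
        unfolding J_def set_lebesgue_integral_def
      proof (intro integral_mono_AE)
        show "integrable lebesgue (\<lambda>t. indicator {y..z} t *\<^sub>R ((w' t)\<^sup>2 * exp (lam * t)))"
          using int_yz by (simp add: set_integrable_def)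
        have "set_integrable lebesgue {y<..<b} (\<lambda>t. (w' t)\<^sup>2 * exp (lam * t))"
          using y by (intro set_integrable_subset[OF int]) auto
        then show "integrable lebesgue (\<lambda>t. indicator {y<..<b} t *\<^sub>R ((w' t)\<^sup>2 * exp (lam * t)))"
          by (simp add: set_integrable_def)
        assume "AE t in lebesgue. t \<noteq> y"
        then show "AE t in lebesgue. indicator {y..z} t *\<^sub>R ((w' t)\<^sup>2 * exp (lam * t))
            \<le> indicator {y<..<b} t *\<^sub>R ((w' t)\<^sup>2 * exp (lam * t))"
          by eventually_elim (use z in \<open>auto split: split_indicator\<close>)
      qed
    qed
    finally have "(w z - w y)\<^sup>2 \<le> J * (LINT t:{y..z}|lebesgue. exp (- lam * t))"
      by (simp add: mult_right_mono set_lebesgue_integral_def)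
    also have "\<dots> \<le> J * (exp (- lam * y) / lam)"
      using z \<open>lam > 0\<close>
      by (intro mult_left_mono LINT_exp_Icc_le) (auto simp: J_def set_lebesgue_integral_def)
    finally show ?thesis
      by (simp add: mult.commute)
  qed
  \<comment> \<open>Continuity up to the end point lets \<open>z\<close> tend to \<open>b\<close>,
    where \<open>w b = 0\<close> leaves only \<open>w y\<close>.\<close>
  have "(w \<longlongrightarrow> w b) (at b within {a..b})"
    using cont y by (simp add: continuous_on_def)
  then have "(w \<longlongrightarrow> w b) (at_left b)"
    using y by (simp add: at_within_Icc_at_left)
  then have "((\<lambda>z. (w z - w y)\<^sup>2) \<longlongrightarrow> (w b - w y)\<^sup>2) (at_left b)"
    by (intro tendsto_intros)
  moreover have "eventually (\<lambda>z. (w z - w y)\<^sup>2 \<le> exp (- lam * y) / lam * J) (at_left b)"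
    using eventually_at_left_real[OF y(2)] by eventually_elim (rule bound, auto)
  ultimately have "(w b - w y)\<^sup>2 \<le> exp (- lam * y) / lam * J"
    by (rule tendsto_upperbound) simp
  then show ?thesis
    by (simp add: \<open>w b = 0\<close> J_def)
qed

text \<open>Subtracting half of the left side reduces the claim to
  \<open>lam\<^sup>2 * B \<le> A\<close>. This is proved with nonnegative integrals, where the order
  of integration may be exchanged freely.\<close>

theorem lemma4p1:
  fixes a b lam :: real and w w' :: "real \<Rightarrow> real"
  assumes "a < b" and "a > 0" and "lam > 0"
    and "w \<in> H1_tilde a b"
    and "has_weak_derivative_on a b w w'"
  shows "(LINT y:{a<..<b}|lebesgue. (w' y)\<^sup>2 * exp (2 * lam * y))
     \<ge> 1/2 * (LINT y:{a<..<b}|lebesgue. (w' y)\<^sup>2 * exp (2 * lam * y))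
       + 1/2 * lam\<^sup>2 * (LINT y:{a<..<b}|lebesgue. (w y)\<^sup>2 * exp (2 * lam * y))"
proof -
  define A where "A = (LINT y:{a<..<b}|lebesgue. (w' y)\<^sup>2 * exp (2 * lam * y))"
  define B where "B = (LINT y:{a<..<b}|lebesgue. (w y)\<^sup>2 * exp (2 * lam * y))"
  let ?q = "\<lambda>t. indicat_real {a<..<b} t * ((w' t)\<^sup>2 * exp (lam * t))"
  have cont: "continuous_on {a..b} w" and H1: "w \<in> H1 a b"
    using \<open>w \<in> H1_tilde a b\<close> by (auto simp: H1_tilde_def H1_def)
  have int: "set_integrable lebesgue {a<..<b} (\<lambda>t. (w' t)\<^sup>2 * exp (c * t))" for c
    by (intro set_integrable_mult_continuous continuous_intros
        weak_derivative_set_integrable_square[OF H1 \<open>has_weak_derivative_on a b w w'\<close>])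
  have "?q \<in> borel_measurable lebesgue"
    using int[of lam] borel_measurable_integrable unfolding set_integrable_def by fastforce
  \<comment> \<open>The exchange of integrals is stated for Borel functions, hence a Borel version
    of \<open>?q\<close>.\<close>
  then obtain q where q [measurable]: "q \<in> borel_measurable borel" and "AE t in lborel. ?q t = q t"
    using completion_ex_borel_measurable_real[of ?q lborel] by auto
  then have ae: "AE t in lebesgue. ?q t = q t"
    by (intro AE_completion)
  have tail: "(w y)\<^sup>2 * exp (2 * lam * y)
      \<le> exp (lam * y) / lam * (LINT t:{y<..<b}|lebesgue. (w' t)\<^sup>2 * exp (lam * t))"
    if "a < y" "y < b" for y
  proof -
    have "(w y)\<^sup>2 * exp (2 * lam * y)
        \<le> exp (- lam * y) / lam * (LINT t:{y<..<b}|lebesgue. (w' t)\<^sup>2 * exp (lam * t)) * exp (2 * lam * y)"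
      using that assms by (intro mult_right_mono H1_tilde_square_le[of lam w a b w' y]) auto
    also have "\<dots> = (exp (- lam * y) * exp (2 * lam * y)) / lam
        * (LINT t:{y<..<b}|lebesgue. (w' t)\<^sup>2 * exp (lam * t))"
      by simp
    also have "exp (- lam * y) * exp (2 * lam * y) = exp (lam * y)"
      by (simp flip: exp_add)
    finally show ?thesis .
  qed
  \<comment> \<open>Integrability of the tail makes its real integral equal to the nonnegative
    one.\<close>
  have tail_nn: "ennreal (LINT t:{y<..<b}|lebesgue. (w' t)\<^sup>2 * exp (lam * t))
      = (\<integral>\<^sup>+t\<in>{y<..<b}. ennreal (q t) \<partial>lborel)" if "a < y" for y
  proof -
    have "set_integrable lebesgue {y<..<b} (\<lambda>t. (w' t)\<^sup>2 * exp (lam * t))"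
      using that by (intro set_integrable_subset[OF int]) auto
    then have "ennreal (LINT t:{y<..<b}|lebesgue. (w' t)\<^sup>2 * exp (lam * t))
        = (\<integral>\<^sup>+t. ennreal (indicator {y<..<b} t *\<^sub>R ((w' t)\<^sup>2 * exp (lam * t))) \<partial>lebesgue)"
      unfolding set_integrable_def set_lebesgue_integral_def
      by (intro nn_integral_eq_integral[symmetric] AE_I2) auto
    also have "\<dots> = (\<integral>\<^sup>+t\<in>{y<..<b}. ennreal (q t) \<partial>lebesgue)"
      using ae that
      by (intro nn_integral_cong_AE) (elim eventually_mono, auto split: split_indicator)
    finally show ?thesis
      by (simp add: nn_integral_completion)
  qed

  \<comment> \<open>Continuity of \<open>w\<close> on \<open>[a, b]\<close> gives integrability, so
    \<open>B\<close> is a genuine integral and not the default value 0.\<close>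
  have "set_integrable lebesgue {a<..<b} (\<lambda>y. (w y)\<^sup>2 * exp (2 * lam * y))"
  proof (rule set_integrable_subset)
    show "set_integrable lebesgue {a..b} (\<lambda>y. (w y)\<^sup>2 * exp (2 * lam * y))"
      by (intro absolutely_integrable_continuous_real continuous_intros cont)
  qed auto
  then have "ennreal B = (\<integral>\<^sup>+y. ennreal (indicator {a<..<b} y *\<^sub>R ((w y)\<^sup>2 * exp (2 * lam * y))) \<partial>lebesgue)"
    unfolding set_integrable_def set_lebesgue_integral_def B_def
    by (intro nn_integral_eq_integral[symmetric] AE_I2) auto
  also have "\<dots> \<le> (\<integral>\<^sup>+y\<in>{a<..<b}. (ennreal (exp (lam * y) / lam)
      * (\<integral>\<^sup>+t\<in>{y<..<b}. ennreal (q t) \<partial>lborel)) \<partial>lebesgue)"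
  proof (rule nn_integral_mono)
    fix y
    show "ennreal (indicator {a<..<b} y *\<^sub>R ((w y)\<^sup>2 * exp (2 * lam * y)))
        \<le> ennreal (exp (lam * y) / lam) * (\<integral>\<^sup>+t\<in>{y<..<b}. ennreal (q t) \<partial>lborel) * indicator {a<..<b} y"
    proof (cases "y \<in> {a<..<b}")
      case True
      then have y: "a < y" "y < b"
        by auto
      have "ennreal ((w y)\<^sup>2 * exp (2 * lam * y))
          \<le> ennreal (exp (lam * y) / lam * (LINT t:{y<..<b}|lebesgue. (w' t)\<^sup>2 * exp (lam * t)))"
        by (intro ennreal_leI tail y)
      also have "\<dots> = ennreal (exp (lam * y) / lam) * (\<integral>\<^sup>+t\<in>{y<..<b}. ennreal (q t) \<partial>lborel)"
        using \<open>lam > 0\<close> tail_nn[OF y(1)]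
        by (subst ennreal_mult) (auto simp: set_lebesgue_integral_def)
      finally show ?thesis
        using True by simp
    qed simp
  qed
  also have "\<dots> = (\<integral>\<^sup>+y\<in>{a<..<b}. (ennreal (exp (lam * y) / lam)
      * (\<integral>\<^sup>+t\<in>{y<..<b}. ennreal (q t) \<partial>lborel)) \<partial>lborel)"
    by (rule nn_integral_completion)
  also have "\<dots> \<le> (\<integral>\<^sup>+t\<in>{a<..<b}. (ennreal (q t) * ennreal (exp (lam * t) / lam\<^sup>2)) \<partial>lborel)"
    using \<open>lam > 0\<close> by (intro set_nn_integral_exp_tail_le) auto
  also have "\<dots> = (\<integral>\<^sup>+t\<in>{a<..<b}. (ennreal (q t) * ennreal (exp (lam * t) / lam\<^sup>2)) \<partial>lebesgue)"
    by (rule nn_integral_completion[symmetric])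
  \<comment> \<open>The factor \<open>exp (lam * t)\<close> inside \<open>q\<close> and the one from
    the exchange combine to the weight \<open>exp (2 * lam * t)\<close>.\<close>
  also have "\<dots> = (\<integral>\<^sup>+t. ennreal (1 / lam\<^sup>2 * (indicator {a<..<b} t *\<^sub>R ((w' t)\<^sup>2 * exp (2 * lam * t)))) \<partial>lebesgue)"
  proof (rule nn_integral_cong_AE)
    have "ennreal (?q t) * ennreal (exp (lam * t) / lam\<^sup>2) * indicator {a<..<b} t
        = ennreal (1 / lam\<^sup>2 * (indicator {a<..<b} t *\<^sub>R ((w' t)\<^sup>2 * exp (2 * lam * t))))" for t
    proof (cases "t \<in> {a<..<b}")
      case True
      have "exp (2 * lam * t) = exp (lam * t) * exp (lam * t)"
        by (simp flip: exp_add)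
      then show ?thesis
        using True by (simp add: ennreal_mult[symmetric] mult.assoc)
    qed simp
    with ae show "AE t in lebesgue. ennreal (q t) * ennreal (exp (lam * t) / lam\<^sup>2) * indicator {a<..<b} t
        = ennreal (1 / lam\<^sup>2 * (indicator {a<..<b} t *\<^sub>R ((w' t)\<^sup>2 * exp (2 * lam * t))))"
      by (elim eventually_mono) metis
  qed
  also have "\<dots> = ennreal (1 / lam\<^sup>2 * A)"
    unfolding A_def set_lebesgue_integral_def
    using int[of "2 * lam"] unfolding set_integrable_def
    by (subst nn_integral_eq_integral) auto
  \<comment> \<open>Since \<open>A\<close> is nonnegative, the comparison of extended values
    descends to the reals.\<close>
  finally have "B \<le> 1 / lam\<^sup>2 * A"
    by (subst (asm) ennreal_le_iff) (auto simp: A_def set_lebesgue_integral_def)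
  then have "lam\<^sup>2 * B \<le> A"
    using \<open>lam > 0\<close> by (simp add: field_simps)
  then show ?thesis
    unfolding A_def[symmetric] B_def[symmetric] by simp
qed

end
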